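(* There is an absolute constant $\epsilon_0>0$ such that, for ranges $R\subseteq\mathbb{R}$ with $|R|=o(\sqrt d)$, every (possibly adaptive, $2$-sided error) unateness tester for functions $f:\{0,1\}^d\to R$ with proximity parameter $\epsilon_0$ must make $\Omega(|R|^2)$ queries.
   Context: A function $f:\{0,1\}^d\to\mathbb{R}$ is unate if each dimension $i\in[d]$ can be assigned a direction up or down such that: if up, $f(x)\le f(x+e_i)$ for all $x$ with $x_i=0$ (here $x+e_i$ is $x$ with the $i$-th bit set to 1); if down, $f(x)\ge f(x+e_i)$ for all such $x$. The distance between two functions is the fraction of points where they differ; $f$ is $\epsilon$-far from unate if its distance to every unate function is at least $\epsilon$. A unateness tester is a randomized algorithm that, given $\epsilon$ and oracle (query) access to $f$, accepts with probability at least $2/3$ if $f$ is unate and rejects with probability at least $2/3$ if $f$ is $\epsilon$-far from unate; it may choose queries adaptively and may err on both sides. *)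

theory Defs
  imports "HOL-Probability.Probability" "HOL-Library.Landau_Symbols"
begin

definition cube :: "nat \<Rightarrow> bool list set" where
  "cube d = {x. length x = d}"

definition unate :: "nat \<Rightarrow> (bool list \<Rightarrow> real) \<Rightarrow> bool" where
  "unate d g \<longleftrightarrow> (\<exists>up :: nat \<Rightarrow> bool. \<forall>i<d. \<forall>x\<in>cube d. \<not> x ! i \<longrightarrow>
      (up i \<longrightarrow> g x \<le> g (x[i := True])) \<and> (\<not> up i \<longrightarrow> g x \<ge> g (x[i := True])))"

definition dist_cube :: "nat \<Rightarrow> (bool list \<Rightarrow> real) \<Rightarrow> (bool list \<Rightarrow> real) \<Rightarrow> real" where
  "dist_cube d f g = real (card {x\<in>cube d. f x \<noteq> g x}) / 2 ^ d"

definition far_from_unate :: "nat \<Rightarrow> real \<Rightarrow> (bool list \<Rightarrow> real) \<Rightarrow> bool" where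
  "far_from_unate d \<epsilon> f \<longleftrightarrow> (\<forall>g. unate d g \<longrightarrow> dist_cube d f g \<ge> \<epsilon>)"

text \<open>Deterministic adaptive query algorithms as decision trees: a leaf outputs
  accept/reject, an inner node queries a point and branches on the answer.\<close>
datatype qtree = Leaf bool | Query "bool list" "real \<Rightarrow> qtree"

primrec run :: "nat \<Rightarrow> qtree \<Rightarrow> (bool list \<Rightarrow> real) \<Rightarrow> bool" where
  "run d (Leaf b) f = b"
| "run d (Query x k) f = run d (k (if x \<in> cube d then f x else 0)) f"

inductive depth_le :: "qtree \<Rightarrow> nat \<Rightarrow> bool" where
  "depth_le (Leaf b) n"
| "(\<And>r. depth_le (k r) n) \<Longrightarrow> depth_le (Query x k) (Suc n)"

text \<open>A randomized (adaptive, two-sided error) tester = a probability distribution over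
  deterministic decision trees, each making at most q queries.\<close>
definition unateness_tester ::
  "nat \<Rightarrow> real set \<Rightarrow> real \<Rightarrow> qtree pmf \<Rightarrow> nat \<Rightarrow> bool" where
  "unateness_tester d R \<epsilon> T q \<longleftrightarrow>
     (\<forall>t\<in>set_pmf T. depth_le t q) \<and>
     (\<forall>f. (\<forall>x\<in>cube d. f x \<in> R) \<longrightarrow>
        (unate d f \<longrightarrow> measure_pmf.prob T {t. run d t f} \<ge> 2/3) \<and>
        (far_from_unate d \<epsilon> f \<longrightarrow> measure_pmf.prob T {t. \<not> run d t f} \<ge> 2/3))"

end

theory Submission
  imports Defs
begin

text \<open>
  For disjoint sets \<open>A\<close>, \<open>B\<close> of the first \<open>m \<approx> r\<^sup>2 / 16\<close> coordinates consider
  \<open>|x| - a(x) - b(x)\<close>, where \<open>a\<close>, \<open>b\<close> are the parities of \<open>x\<close> on \<open>A\<close> and \<open>B\<close>, clipped to the \<open>r\<close> middle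
  values. Each edge flips at most one parity, so the function is monotone. If a single \<open>i\<close> is added to
  both sets, the edges in direction \<open>i\<close> flip both parities, and a constant fraction of them is
  decreasing and a constant fraction increasing.

  To hide \<open>i\<close>, choose a random partition of the other coordinates into \<open>T\<close> and \<open>W\<close> and random sets
  \<open>A \<subseteq> T\<close>, \<open>B \<subseteq> W\<close>. A leaf of a decision tree imposes linear equations over the field with two elements
  on \<open>A\<close> and, separately, on \<open>B\<close>. Unless these equations force \<open>i \<notin> A\<close> (with \<open>i\<close> moved into \<open>T\<close>) or
  \<open>i \<notin> B\<close> (with \<open>i\<close> moved into \<open>W\<close>), the leaf is reached equally often with and without \<open>i\<close> in both
  sets, because translation by a solution of the homogeneous system containing \<open>i\<close> is a bijection. As \<open>q\<close>
  equations force at most \<open>q\<close> coordinates, the acceptance probabilities differ by \<open>O(q / m)\<close>.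
\<close>

subsection \<open>Decision trees that query two parities\<close>

text \<open>Sets stand for their indicator vectors, so \<open>sym_diff\<close> is vector addition
  and a pair \<open>(x, a)\<close> is the equation "inner product with \<open>x\<close> equals
  \<open>a\<close>".\<close>

definition solutions :: "(nat set \<times> bool) list \<Rightarrow> nat set \<Rightarrow> nat set set" where
  "solutions cs T = {A. A \<subseteq> T \<and> (\<forall>(x, a)\<in>set cs. odd (card (A \<inter> x)) = a)}"

lemma finite_solutions: "finite T \<Longrightarrow> finite (solutions cs T)"
  by (rule finite_subset[of _ "Pow T"]) (auto simp: solutions_def)

lemma solutions_mono: "T \<subseteq> T' \<Longrightarrow> solutions cs T \<subseteq> solutions cs T'"
  by (auto simp: solutions_def)

lemma odd_card_sym_diff:
  assumes "finite A" "finite B"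
  shows "odd (card (sym_diff A B)) = (odd (card A) \<noteq> odd (card B))"
proof -
  have "card A = card (A - B) + card (A \<inter> B)" "card B = card (B - A) + card (A \<inter> B)"
    using assms card_Int_Diff[of A B] card_Int_Diff[of B A] by (simp_all add: Int_commute)
  moreover have "card (sym_diff A B) = card (A - B) + card (B - A)"
    using assms by (intro card_Un_disjoint) auto
  ultimately show ?thesis by presburger
qed

lemma odd_card_sym_diff_Int:
  assumes "finite A" "finite B"
  shows "odd (card (sym_diff A B \<inter> x)) = (odd (card (A \<inter> x)) \<noteq> odd (card (B \<inter> x)))"
proof -
  have "sym_diff A B \<inter> x = sym_diff (A \<inter> x) (B \<inter> x)" by auto
  then show ?thesis using assms by (simp add: odd_card_sym_diff)
qed

text \<open>An affine subspace is closed under sums of an odd number of its elements. This form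
  avoids introducing the homogeneous system.\<close>

lemma solutions_sym_diff3:
  assumes "finite T" "A \<in> solutions cs T" "B \<in> solutions cs T" "C \<in> solutions cs T"
  shows "sym_diff A (sym_diff B C) \<in> solutions cs T"
proof -
  have "finite A" "finite B" "finite C"
    using assms by (auto simp: solutions_def intro: finite_subset)
  then have "odd (card (sym_diff A (sym_diff B C) \<inter> x)) =
      (odd (card (A \<inter> x)) \<noteq> (odd (card (B \<inter> x)) \<noteq> odd (card (C \<inter> x))))" for x
    using odd_card_sym_diff_Int[of A "sym_diff B C" x] odd_card_sym_diff_Int[of B C x] by simp
  then show ?thesis using assms(2-4) by (auto simp: solutions_def)
qed

text \<open>The sum of the solutions \<open>B\<close> and \<open>C\<close> solves the homogeneous
  system, so adding it is an involution of the solution set; by hypothesis it flips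
  \<open>P\<close>.\<close>

lemma card_solutions_split:
  assumes "finite T"
    and B: "B \<in> solutions cs T" "P B" and C: "C \<in> solutions cs T" "\<not> P C"
    and P: "\<And>A. A \<in> solutions cs T \<Longrightarrow> P (sym_diff A (sym_diff B C)) \<longleftrightarrow> \<not> P A"
  shows "card {A \<in> solutions cs T. P A} = card {A \<in> solutions cs T. \<not> P A}"
proof -
  have inv: "sym_diff (sym_diff A (sym_diff B C)) (sym_diff B C) = A" for A by auto
  have mem: "sym_diff A (sym_diff B C) \<in> solutions cs T" if "A \<in> solutions cs T" for A
    using solutions_sym_diff3[OF assms(1) that B(1) C(1)] .
  have "bij_betw (\<lambda>A. sym_diff A (sym_diff B C)) {A \<in> solutions cs T. P A} {A \<in> solutions cs T. \<not> P A}"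
    by (rule bij_betwI[where g = "\<lambda>A. sym_diff A (sym_diff B C)"]) (use mem P inv in \<open>simp_all\<close>)
  then show ?thesis by (rule bij_betw_same_card)
qed

text \<open>A further equation that stays solvable either holds on the whole solution set or halves
  it exactly.\<close>

lemma card_solutions_ge:
  assumes "finite T" "solutions cs T \<noteq> {}"
  shows "2 ^ card T \<le> card (solutions cs T) * 2 ^ length cs"
  using assms(2)
proof (induction cs)
  case Nil
  have "solutions [] T = Pow T" by (auto simp: solutions_def)
  then show ?case using assms(1) by (simp add: card_Pow)
next
  case (Cons p cs)
  obtain x a where p: "p = (x, a)" by (cases p)
  let ?S = "solutions cs T"
  let ?P = "\<lambda>A :: nat set. odd (card (A \<inter> x)) = a"
  have eq: "solutions (p # cs) T = {A \<in> ?S. ?P A}"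
    unfolding p by (auto simp: solutions_def)
  then have ne: "?S \<noteq> {}" and exP: "\<exists>B\<in>?S. ?P B" using Cons.prems by auto
  note fin = finite_solutions[OF assms(1), of cs]
  have "card ?S \<le> 2 * card {A \<in> ?S. ?P A}"
  proof (cases "\<exists>C\<in>?S. \<not> ?P C")
    case True
    then obtain B C where BC: "B \<in> ?S" "?P B" "C \<in> ?S" "\<not> ?P C" using exP by auto
    have "?P (sym_diff A (sym_diff B C)) \<longleftrightarrow> \<not> ?P A" if "A \<in> ?S" for A
    proof -
      have "finite A" "finite B" "finite C"
        using assms(1) that BC(1,3) finite_subset[of _ T] by (auto simp: solutions_def)
      then show ?thesis
        using odd_card_sym_diff_Int[of A "sym_diff B C" x] odd_card_sym_diff_Int[of B C x] BC(2,4)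
        by (simp del: Un_iff)
    qed
    from card_solutions_split[of T B cs ?P C, OF assms(1) BC this]
    have "card {A \<in> ?S. ?P A} = card {A \<in> ?S. \<not> ?P A}" .
    moreover have "card ?S = card {A \<in> ?S. ?P A} + card {A \<in> ?S. \<not> ?P A}"
      using fin by (subst card_Un_disjoint[symmetric]) (auto intro!: arg_cong[where f = card])
    ultimately show ?thesis by simp
  next
    case False
    then have "{A \<in> ?S. ?P A} = ?S" by auto
    then show ?thesis by simp
  qed
  from order_trans[OF Cons.IH[OF ne] mult_le_mono1[OF this]] show ?case
    unfolding eq by (simp add: mult_ac)
qed

text \<open>If the coordinates in \<open>?J\<close> are forced to be absent, all solutions lie in a
  cube of dimension \<open>card T - card ?J\<close>; but each equation costs at most one
  dimension.\<close>

lemma card_forced_le: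
  assumes "finite T" "solutions cs T \<noteq> {}"
  shows "card {i\<in>T. \<forall>A\<in>solutions cs T. i \<notin> A} \<le> length cs"
proof -
  let ?J = "{i\<in>T. \<forall>A\<in>solutions cs T. i \<notin> A}"
  have "solutions cs T \<subseteq> Pow (T - ?J)" by (auto simp: solutions_def)
  then have "card (solutions cs T) \<le> 2 ^ card (T - ?J)"
    by (metis (no_types, lifting) assms(1) card_Pow card_mono finite_Diff finite_Pow_iff)
  then have "2 ^ card T \<le> (2::nat) ^ card (T - ?J) * 2 ^ length cs"
    using card_solutions_ge[OF assms] by (meson le_trans mult_le_mono1)
  then have "card T \<le> card (T - ?J) + length cs"
    by (simp add: power_add[symmetric])
  moreover have "card T = card (T - ?J) + card ?J"
    using assms(1) by (metis (no_types, lifting) card_Diff_subset card_mono finite_subset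
        le_add_diff_inverse2 mem_Collect_eq subsetI)
  ultimately show ?thesis by simp
qed

text \<open>Translation by the sum of \<open>B\<close> and \<open>C\<close> toggles
  \<open>i\<close>, so it matches the solutions containing \<open>i\<close> with those avoiding it;
  the latter are the solutions inside \<open>T\<close>.\<close>

lemma card_solutions_insert:
  assumes "finite T" "i \<notin> T" "B \<in> solutions cs T" "C \<in> solutions cs (insert i T)" "i \<in> C"
  shows "card {A \<in> Pow T. insert i A \<in> solutions cs (insert i T)} = card (solutions cs T)"
proof -
  let ?S = "solutions cs (insert i T)"
  have B: "B \<in> ?S" "i \<notin> B" using assms by (auto simp: solutions_def)
  have "card {A \<in> ?S. i \<notin> A} = card {A \<in> ?S. \<not> i \<notin> A}"
    by (rule card_solutions_split[where B = B and C = C]) (use assms B in auto)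
  moreover have "{A \<in> ?S. i \<notin> A} = solutions cs T" using assms(2) by (auto simp: solutions_def)
  moreover have "bij_betw (insert i) {A \<in> Pow T. insert i A \<in> ?S} {A \<in> ?S. \<not> i \<notin> A}"
    by (rule bij_betwI[where g = "\<lambda>A. A - {i}"])
      (use assms(2) in \<open>auto simp: solutions_def insert_absorb\<close>)
  then have "card {A \<in> Pow T. insert i A \<in> ?S} = card {A \<in> ?S. \<not> i \<notin> A}"
    by (rule bij_betw_same_card)
  ultimately show ?thesis by simp
qed

section \<open>Weighted count of forced coordinates\<close>

text \<open>\<open>T\<close> and \<open>N - T\<close> are the coordinates at which \<open>A\<close> and \<open>B\<close>, respectively, may be nonzero.\<close>
definition weight :: "nat set \<Rightarrow> (nat set \<times> bool) list \<Rightarrow> (nat set \<times> bool) list \<Rightarrow> real" where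
  "weight N cs cs' = (\<Sum>T\<in>Pow N. real (card (solutions cs T)) * real (card (solutions cs' (N - T))))"

lemma weight_swap: "weight N cs cs' = weight N cs' cs"
  unfolding weight_def
  by (rule sum.reindex_bij_witness[of _ "\<lambda>T. N - T" "\<lambda>T. N - T"])
    (simp_all add: Diff_Diff_Int Int_absorb1 mult.commute)

text \<open>Move \<open>i\<close> into \<open>T\<close>: the triple \<open>i\<close>,
  \<open>T\<close>, \<open>N - {i} - T\<close> becomes a split of \<open>N\<close> with a marked
  forced element of its first half. Each split has at most \<open>length cs\<close> such elements by
  \<open>card_forced_le\<close>.\<close>

lemma forced_weight_le:
  assumes "finite N"
  shows "(\<Sum>i\<in>N. \<Sum>T\<in>Pow (N - {i}). real (card (solutions cs T)) * real (card (solutions cs' (N - {i} - T)))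
      * of_bool (\<forall>A\<in>solutions cs (insert i T). i \<notin> A)) \<le> real (length cs) * weight N cs cs'"
    (is "?L \<le> _")
proof -
  let ?g = "\<lambda>T i. real (card (solutions cs T)) * real (card (solutions cs' (N - T)))
      * of_bool (\<forall>A\<in>solutions cs T. i \<notin> A)"
  have "?L \<le> (\<Sum>i\<in>N. \<Sum>T\<in>Pow (N - {i}). ?g (insert i T) i)"
  proof (intro sum_mono mult_right_mono mult_mono)
    fix i T assume "i \<in> N" "T \<in> Pow (N - {i})"
    then have "finite T" using assms by (auto intro: finite_subset)
    then show "real (card (solutions cs T)) \<le> real (card (solutions cs (insert i T)))"
      by (intro of_nat_mono card_mono finite_solutions solutions_mono) auto
    show "real (card (solutions cs' (N - {i} - T))) \<le> real (card (solutions cs' (N - insert i T)))"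
      by (subst Diff_insert2) (rule order_refl)
  qed auto
  also have "\<dots> = (\<Sum>(i, T)\<in>Sigma N (\<lambda>i. Pow (N - {i})). ?g (insert i T) i)"
    using assms by (intro sum.Sigma) auto
  also have "\<dots> = (\<Sum>(T, i)\<in>Sigma (Pow N) (\<lambda>T. T). ?g T i)"
    by (rule sum.reindex_bij_witness[of _ "\<lambda>(T, i). (i, T - {i})" "\<lambda>(i, T). (insert i T, i)"])
      (auto simp: insert_absorb)
  also have "\<dots> = (\<Sum>T\<in>Pow N. \<Sum>i\<in>T. ?g T i)"
    using assms by (intro sum.Sigma[symmetric]) (auto intro: finite_subset)
  also have "\<dots> \<le> (\<Sum>T\<in>Pow N. real (length cs) * (real (card (solutions cs T)) * real (card (solutions cs' (N - T)))))"
  proof (intro sum_mono)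
    fix T assume "T \<in> Pow N"
    then have fin: "finite T" using assms by (auto intro: finite_subset)
    show "(\<Sum>i\<in>T. ?g T i) \<le> real (length cs) * (real (card (solutions cs T)) * real (card (solutions cs' (N - T))))"
    proof (cases "solutions cs T = {}")
      case False
      have "(\<Sum>i\<in>T. ?g T i) = real (card (solutions cs T)) * real (card (solutions cs' (N - T)))
          * (\<Sum>i\<in>T. of_bool (\<forall>A\<in>solutions cs T. i \<notin> A))"
        by (simp add: sum_distrib_left)
      also have "(\<Sum>i\<in>T. of_bool (\<forall>A\<in>solutions cs T. i \<notin> A)) = real (card {i\<in>T. \<forall>A\<in>solutions cs T. i \<notin> A})"
        using fin by (simp add: of_bool_def sum.If_cases Int_def)
      also have "\<dots> \<le> real (length cs)"
        using card_forced_le[OF fin False] by simp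
      finally show ?thesis by (simp add: mult_left_mono mult.commute[of "real (length cs)"])
    qed simp
  qed
  finally show ?thesis unfolding weight_def by (simp add: sum_distrib_left)
qed

lemma sum_of_bool_solutions:
  fixes U W :: "nat set"
  assumes "finite U" "finite W"
  shows "(\<Sum>A\<in>Pow U. \<Sum>B\<in>Pow W. of_bool (P A \<and> Q B)) = real (card {A\<in>Pow U. P A}) * real (card {B\<in>Pow W. Q B})"
proof -
  have *: "real (card {A\<in>Pow V. R A}) = (\<Sum>A\<in>Pow V. of_bool (R A))" if "finite V" for V :: "nat set" and R :: "nat set \<Rightarrow> bool"
    using that by (simp add: of_bool_def sum.If_cases Int_def)
  show ?thesis
    by (simp only: *[OF assms(1)] *[OF assms(2)] sum_product of_bool_conj)
qed

section \<open>Acceptance gap of a decision tree\<close>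

definition satisfies :: "nat set \<Rightarrow> (nat set \<times> bool) list \<Rightarrow> bool" where
  "satisfies A cs \<longleftrightarrow> (\<forall>(x, a)\<in>set cs. odd (card (A \<inter> x)) = a)"

lemma solutions_eq: "solutions cs T = {A\<in>Pow T. satisfies A cs}"
  by (auto simp: solutions_def satisfies_def)

text \<open>The unnormalised loss in acceptances when \<open>i\<close> is added to both sets,
  restricted to the pairs whose parities agree with the answers \<open>cs\<close> and
  \<open>cs'\<close> recorded along one path of the tree.\<close>

definition gap :: "nat set \<Rightarrow> (nat set \<times> bool) list \<Rightarrow> (nat set \<times> bool) list \<Rightarrow> (nat set \<Rightarrow> nat set \<Rightarrow> bool) \<Rightarrow> real" where
  "gap N cs cs' acc = (\<Sum>i\<in>N. \<Sum>T\<in>Pow (N - {i}). \<Sum>A\<in>Pow T. \<Sum>B\<in>Pow (N - {i} - T).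
     of_bool (satisfies A cs \<and> satisfies B cs' \<and> acc A B)
     - of_bool (satisfies (insert i A) cs \<and> satisfies (insert i B) cs' \<and> acc (insert i A) (insert i B)))"

text \<open>For fixed \<open>i\<close> and \<open>T\<close>, the counts with and without
  \<open>i\<close> cancel by \<open>card_solutions_insert\<close> unless \<open>i\<close> is forced
  out on one of the two sides. In the forced cases the loss is at most the number of solution pairs,
  which \<open>forced_weight_le\<close> sums up.\<close>

lemma gap_leaf:
  assumes "finite N"
  shows "gap N cs cs' (\<lambda>_ _. v) \<le> (real (length cs) + real (length cs')) * weight N cs cs'"
proof (cases v)
  case False
  have "0 \<le> weight N cs cs'" by (simp add: weight_def sum_nonneg)
  then show ?thesis using False by (simp add: gap_def)
next
  case True
  let ?a = "\<lambda>T. real (card (solutions cs T))" and ?b = "\<lambda>T. real (card (solutions cs' T))"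
  let ?fa = "\<lambda>i T. of_bool (\<forall>A\<in>solutions cs (insert i T). i \<notin> A)"
  let ?fb = "\<lambda>i T. of_bool (\<forall>A\<in>solutions cs' (insert i T). i \<notin> A)"
  have "gap N cs cs' (\<lambda>_ _. v) \<le> (\<Sum>i\<in>N. \<Sum>T\<in>Pow (N - {i}).
      ?a T * ?b (N - {i} - T) * ?fa i T + ?b (N - {i} - T) * ?a T * ?fb i (N - {i} - T))"
    unfolding gap_def
  proof (intro sum_mono)
    fix i T assume i: "i \<in> N" and T: "T \<in> Pow (N - {i})"
    let ?W = "N - {i} - T"
    have fin: "finite T" "finite ?W" and ni: "i \<notin> T" "i \<notin> ?W"
      using assms T finite_subset[of T N] by auto
    have ins: "real (card {A\<in>Pow U. satisfies (insert i A) es}) =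
        (if \<forall>A\<in>solutions es (insert i U). i \<notin> A then 0 else real (card (solutions es U)))"
      if U: "finite U" "i \<notin> U" "solutions es U \<noteq> {}" for U es
    proof (cases "\<forall>A\<in>solutions es (insert i U). i \<notin> A")
      case True
      have "\<not> satisfies (insert i A) es" if "A \<subseteq> U" for A
      proof
        assume "satisfies (insert i A) es"
        then have "insert i A \<in> solutions es (insert i U)" using that by (auto simp: solutions_eq)
        then show False using True by blast
      qed
      then have none: "{A\<in>Pow U. satisfies (insert i A) es} = {}" by auto
      show ?thesis unfolding none using True by simp
    next
      case False
      have eq: "{A\<in>Pow U. satisfies (insert i A) es} = {A\<in>Pow U. insert i A \<in> solutions es (insert i U)}"
        by (auto simp: solutions_eq)
      obtain B C where "B \<in> solutions es U" "C \<in> solutions es (insert i U)" "i \<in> C"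
        using False U(3) by blast
      from card_solutions_insert[OF U(1,2) this] show ?thesis
        unfolding eq using False by (simp only: if_False)
    qed
    have "(\<Sum>A\<in>Pow T. \<Sum>B\<in>Pow ?W.
        of_bool (satisfies A cs \<and> satisfies B cs' \<and> v)
        - of_bool (satisfies (insert i A) cs \<and> satisfies (insert i B) cs' \<and> v))
      = ?a T * ?b ?W - real (card {A\<in>Pow T. satisfies (insert i A) cs})
          * real (card {B\<in>Pow ?W. satisfies (insert i B) cs'})"
      by (simp only: True simp_thms sum_subtractf sum_of_bool_solutions[OF fin] solutions_eq)
    also have "\<dots> \<le> ?a T * ?b ?W * ?fa i T + ?b ?W * ?a T * ?fb i ?W"
    proof (cases "solutions cs T = {} \<or> solutions cs' ?W = {}")
      case True
      then show ?thesis by auto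
    next
      case False
      then have ne: "solutions cs T \<noteq> {}" "solutions cs' ?W \<noteq> {}" by auto
      have "a * b - (if p then 0 else a) * (if q then 0 else b) \<le> a * b * of_bool p + b * a * of_bool q"
        if "0 \<le> a" "0 \<le> b" for a b :: real and p q
        using that by auto
      then show ?thesis
        unfolding ins[OF fin(1) ni(1) ne(1)] ins[OF fin(2) ni(2) ne(2)] by simp
    qed
    finally show "(\<Sum>A\<in>Pow T. \<Sum>B\<in>Pow ?W.
        of_bool (satisfies A cs \<and> satisfies B cs' \<and> v)
        - of_bool (satisfies (insert i A) cs \<and> satisfies (insert i B) cs' \<and> v))
       \<le> ?a T * ?b ?W * ?fa i T + ?b ?W * ?a T * ?fb i ?W" .
  qed
  also have "\<dots> = (\<Sum>i\<in>N. \<Sum>T\<in>Pow (N - {i}). ?a T * ?b (N - {i} - T) * ?fa i T)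
      + (\<Sum>i\<in>N. \<Sum>T\<in>Pow (N - {i}). ?b (N - {i} - T) * ?a T * ?fb i (N - {i} - T))"
    by (simp add: sum.distrib)
  \<comment> \<open>Complementing \<open>T\<close> within \<open>N - {i}\<close> exchanges the roles
    of the two sides, so \<open>forced_weight_le\<close> also covers the second sum.\<close>
  also have "(\<Sum>i\<in>N. \<Sum>T\<in>Pow (N - {i}). ?b (N - {i} - T) * ?a T * ?fb i (N - {i} - T))
      = (\<Sum>i\<in>N. \<Sum>T\<in>Pow (N - {i}). ?b T * ?a (N - {i} - T) * ?fb i T)"
  proof (rule sum.cong[OF refl])
    fix i
    show "(\<Sum>T\<in>Pow (N - {i}). ?b (N - {i} - T) * ?a T * ?fb i (N - {i} - T))
      = (\<Sum>T\<in>Pow (N - {i}). ?b T * ?a (N - {i} - T) * ?fb i T)"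
      by (rule sum.reindex_bij_witness[of _ "\<lambda>T. N - {i} - T" "\<lambda>T. N - {i} - T"])
        (simp_all add: Diff_Diff_Int Int_absorb1 Diff_subset)
  qed
  also have "(\<Sum>i\<in>N. \<Sum>T\<in>Pow (N - {i}). ?a T * ?b (N - {i} - T) * ?fa i T)
      \<le> real (length cs) * weight N cs cs'"
    by (rule forced_weight_le[OF assms])
  also have "(\<Sum>i\<in>N. \<Sum>T\<in>Pow (N - {i}). ?b T * ?a (N - {i} - T) * ?fb i T)
      \<le> real (length cs') * weight N cs cs'"
    using forced_weight_le[OF assms, of cs' cs] unfolding weight_swap[of N cs' cs] .
  finally show ?thesis by (simp add: algebra_simps)
qed

lemma satisfies_Cons [simp]: "satisfies A ((x, a) # cs) \<longleftrightarrow> odd (card (A \<inter> x)) = a \<and> satisfies A cs"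
  by (auto simp: satisfies_def)

lemma weight_split:
  assumes "finite N"
  shows "weight N cs cs' = (\<Sum>a\<in>UNIV. \<Sum>b\<in>UNIV. weight N ((x, a) # cs) ((x, b) # cs'))"
proof -
  have *: "card (solutions es T) = card (solutions ((x, True) # es) T) + card (solutions ((x, False) # es) T)"
    if "T \<subseteq> N" for T es
  proof -
    have "finite T" using assms that by (auto intro: finite_subset)
    then show ?thesis
      by (subst card_Un_disjoint[symmetric])
        (auto simp: finite_solutions solutions_eq intro!: arg_cong[where f = card])
  qed
  have **: "real (card (solutions cs T)) * real (card (solutions cs' (N - T)))
      = (\<Sum>a\<in>UNIV. \<Sum>b\<in>UNIV. real (card (solutions ((x, a) # cs) T)) * real (card (solutions ((x, b) # cs') (N - T))))"
    if "T \<in> Pow N" for T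
    using that *[of T cs] *[of "N - T" cs'] by (simp add: UNIV_bool algebra_simps)
  show ?thesis
    unfolding weight_def by (simp add: ** UNIV_bool sum.distrib)
qed

lemma gap_split:
  "gap N cs cs' acc = (\<Sum>a\<in>UNIV. \<Sum>b\<in>UNIV. gap N ((x, a) # cs) ((x, b) # cs') acc)"
proof -
  have *: "(of_bool (satisfies A cs \<and> satisfies B cs' \<and> acc A B) :: real) =
      (\<Sum>a\<in>UNIV. \<Sum>b\<in>UNIV. of_bool (satisfies A ((x, a) # cs) \<and> satisfies B ((x, b) # cs') \<and> acc A B))" for A B
    by (cases "odd (card (A \<inter> x))"; cases "odd (card (B \<inter> x))") (simp_all add: UNIV_bool del: sum_of_bool_eq)
  show ?thesis
    unfolding gap_def by (subst (1 2) *) (simp add: UNIV_bool sum.distrib sum_subtractf del: sum_of_bool_eq)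
qed

lemma gap_cong:
  assumes "\<And>A B. satisfies A cs \<Longrightarrow> satisfies B cs' \<Longrightarrow> acc A B = acc' A B"
  shows "gap N cs cs' acc = gap N cs cs' acc'"
  unfolding gap_def using assms by (intro sum.cong refl arg_cong2[where f = minus]) auto

text \<open>Since the answer to a query depends on two parities only, the tree may be granted both
  of them. A query then adds one equation to each list, which accounts for
  \<open>2 * real q\<close>, and the weights of the four branches add up to that of the
  node.\<close>

lemma gap_tree:
  assumes N: "finite N"
    and F: "\<And>A B x. x \<in> cube d \<Longrightarrow> F A B x = V x (odd (card (A \<inter> s x))) (odd (card (B \<inter> s x)))"
    and t: "depth_le t q"
  shows "gap N cs cs' (\<lambda>A B. run d t (F A B)) \<le> (real (length cs) + real (length cs') + 2 * real q) * weight N cs cs'"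
  using t
proof (induction t q arbitrary: cs cs' rule: depth_le.induct)
  case (1 b n)
  have "0 \<le> weight N cs cs'" by (simp add: weight_def sum_nonneg)
  then have "(real (length cs) + real (length cs')) * weight N cs cs'
      \<le> (real (length cs) + real (length cs') + 2 * real n) * weight N cs cs'"
    by (intro mult_right_mono) auto
  with gap_leaf[OF N, of cs cs' b] show ?case by simp
next
  case (2 k n x)
  \<comment> \<open>The value 0 off the cube agrees with the answer that \<open>run\<close> gives
    there.\<close>
  define V' where "V' a b = (if x \<in> cube d then V x a b else 0)" for a b
  have "gap N cs cs' (\<lambda>A B. run d (Query x k) (F A B))
      = (\<Sum>a\<in>UNIV. \<Sum>b\<in>UNIV. gap N ((s x, a) # cs) ((s x, b) # cs') (\<lambda>A B. run d (Query x k) (F A B)))"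
    by (rule gap_split)
  \<comment> \<open>Once both parities are fixed, the answer and hence the subtree no longer depend
    on \<open>A\<close> and \<open>B\<close>.\<close>
  also have "\<dots> = (\<Sum>a\<in>UNIV. \<Sum>b\<in>UNIV. gap N ((s x, a) # cs) ((s x, b) # cs') (\<lambda>A B. run d (k (V' a b)) (F A B)))"
    by (intro sum.cong refl gap_cong) (auto simp: V'_def F)
  also have "\<dots> \<le> (\<Sum>a\<in>UNIV. \<Sum>b\<in>UNIV. (real (length cs) + real (length cs') + 2 * real (Suc n)) *
      weight N ((s x, a) # cs) ((s x, b) # cs'))"
  proof (intro sum_mono)
    fix a b
    show "gap N ((s x, a) # cs) ((s x, b) # cs') (\<lambda>A B. run d (k (V' a b)) (F A B))
      \<le> (real (length cs) + real (length cs') + 2 * real (Suc n)) * weight N ((s x, a) # cs) ((s x, b) # cs')"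
      using 2(2)[of "(s x, a) # cs" "(s x, b) # cs'" "V' a b"] by (simp add: algebra_simps)
  qed
  also have "\<dots> = (real (length cs) + real (length cs') + 2 * real (Suc n)) * weight N cs cs'"
    unfolding weight_split[OF N, of cs cs' "s x"] by (simp only: sum_distrib_left)
  finally show ?case .
qed

lemma weight_Nil:
  assumes "finite N"
  shows "weight N [] [] = 4 ^ card N"
proof -
  have "real (card (solutions [] T)) * real (card (solutions [] (N - T))) = 2 ^ card N" if "T \<in> Pow N" for T
  proof -
    have "solutions [] U = Pow U" for U by (auto simp: solutions_def)
    moreover have "finite T" "card N = card T + card (N - T)"
      using assms that by (auto intro: finite_subset simp: card_Diff_subset card_mono finite_subset)
    ultimately show ?thesis using assms by (simp add: card_Pow power_add)
  qed
  then show ?thesis using assms by (simp add: weight_def card_Pow power_mult_distrib[symmetric])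
qed

subsection \<open>The hard functions\<close>

definition support :: "nat \<Rightarrow> bool list \<Rightarrow> nat set" where
  "support d x = {j. j < d \<and> x ! j}"

definition of_support :: "nat \<Rightarrow> nat set \<Rightarrow> bool list" where
  "of_support d S = map (\<lambda>j. j \<in> S) [0..<d]"

lemma support_update:
  assumes "x \<in> cube d" "j < d"
  shows "support d (x[j := True]) = insert j (support d x)"
  using assms by (auto simp: support_def cube_def nth_list_update)

lemma of_support_in_cube [simp]: "of_support d S \<in> cube d"
  by (simp add: of_support_def cube_def)

lemma support_of_support: "S \<subseteq> {..<d} \<Longrightarrow> support d (of_support d S) = S"
  by (auto simp: support_def of_support_def)

lemma finite_cube [simp]: "finite (cube d)"
proof -
  have "finite {x :: bool list. set x \<subseteq> UNIV \<and> length x = d}"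
    by (rule finite_lists_length_eq) simp
  then show ?thesis by (simp add: cube_def)
qed

text \<open>The edges in direction \<open>i\<close> are pairwise disjoint, so choosing one
  disagreeing endpoint of each is injective; resetting bit \<open>i\<close> recovers the
  edge.\<close>

lemma card_le_disagreements:
  assumes i: "i < d"
    and D: "\<And>x. x \<in> D \<Longrightarrow> x \<in> cube d \<and> \<not> x ! i \<and> (f x \<noteq> g x \<or> f (x[i := True]) \<noteq> g (x[i := True]))"
  shows "card D \<le> card {x\<in>cube d. f x \<noteq> g x}"
proof (rule card_inj_on_le)
  let ?h = "\<lambda>x. if f x \<noteq> g x then x else x[i := True]"
  have inv: "(?h x)[i := False] = x" if "x \<in> D" for x
    using D[OF that] by (auto simp: list_update_same_conv cube_def i)
  show "inj_on ?h D"
    by (rule inj_on_inverseI[where g = "\<lambda>x. x[i := False]"]) (rule inv)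
  show "?h ` D \<subseteq> {x\<in>cube d. f x \<noteq> g x}" using D by (auto simp: cube_def)
qed simp

text \<open>Whichever direction a unate \<open>g\<close> assigns to \<open>i\<close>, one of the two
  families of edges violates it, and \<open>g\<close> differs from \<open>f\<close> at an endpoint
  of each edge in that family.\<close>

lemma far_from_unateI:
  assumes i: "i < d"
    and down: "\<epsilon> * 2 ^ d \<le> real (card {x\<in>cube d. \<not> x ! i \<and> f (x[i := True]) < f x})"
    and up: "\<epsilon> * 2 ^ d \<le> real (card {x\<in>cube d. \<not> x ! i \<and> f x < f (x[i := True])})"
  shows "far_from_unate d \<epsilon> f"
  unfolding far_from_unate_def
proof (intro allI impI)
  fix g assume "unate d g"
  then obtain dir where dir: "\<And>x. x \<in> cube d \<Longrightarrow> \<not> x ! i \<Longrightarrow>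
      (dir i \<longrightarrow> g x \<le> g (x[i := True])) \<and> (\<not> dir i \<longrightarrow> g x \<ge> g (x[i := True]))"
    unfolding unate_def using i by blast
  have "\<epsilon> * 2 ^ d \<le> real (card {x\<in>cube d. f x \<noteq> g x})"
  proof (cases "dir i")
    case True
    have "card {x\<in>cube d. \<not> x ! i \<and> f (x[i := True]) < f x} \<le> card {x\<in>cube d. f x \<noteq> g x}"
      by (rule card_le_disagreements[OF i]) (use dir True in force)
    then show ?thesis using down by linarith
  next
    case False
    have "card {x\<in>cube d. \<not> x ! i \<and> f x < f (x[i := True])} \<le> card {x\<in>cube d. f x \<noteq> g x}"
      by (rule card_le_disagreements[OF i]) (use dir False in force)
    then show ?thesis using up by linarith
  qed
  then show "\<epsilon> \<le> dist_cube d f g" by (simp add: dist_cube_def field_simps)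
qed

section \<open>Concentration of the weight of a random set\<close>

text \<open>This is the variance of a sum of independent random signs, one for each element of
  \<open>Y \<inter> M\<close>. A new sign turns the deviation z into z - 1 and z + 1, whose squares
  add up to \<open>2 * z * z + 2\<close>.\<close>

lemma sum_deviation_sq:
  assumes "finite Y"
  shows "(\<Sum>y\<in>Pow Y. (2 * real (card (y \<inter> M)) - real (card (Y \<inter> M)))\<^sup>2) = real (card (Y \<inter> M)) * 2 ^ card Y"
  using assms
proof (induction Y)
  case (insert k Y)
  let ?n = "real (card (Y \<inter> M))"
  let ?z = "\<lambda>y. 2 * real (card (y \<inter> M)) - ?n"
  have "(\<Sum>y\<in>Pow (insert k Y). (2 * real (card (y \<inter> M)) - real (card (insert k Y \<inter> M)))\<^sup>2)
      = (\<Sum>y\<in>Pow Y. (2 * real (card (y \<inter> M)) - real (card (insert k Y \<inter> M)))\<^sup>2)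
      + (\<Sum>y\<in>Pow Y. (2 * real (card (insert k y \<inter> M)) - real (card (insert k Y \<inter> M)))\<^sup>2)"
  proof -
    have "inj_on (insert k) (Pow Y)" using insert.hyps(2) by (intro inj_onI) (metis PowD insert_ident subset_iff)
    moreover have "Pow Y \<inter> insert k ` Pow Y = {}" using insert.hyps(2) by auto
    ultimately show ?thesis using insert.hyps(1)
      by (simp add: Pow_insert sum.union_disjoint sum.reindex)
  qed
  also have "\<dots> = (\<Sum>y\<in>Pow Y. 2 * (?z y)\<^sup>2 + 2 * of_bool (k \<in> M))"
    unfolding sum.distrib[symmetric]
  proof (rule sum.cong[OF refl])
    fix y assume "y \<in> Pow Y"
    then have "finite y" "k \<notin> y" using insert.hyps finite_subset[of y Y] by auto
    then show "(2 * real (card (y \<inter> M)) - real (card (insert k Y \<inter> M)))\<^sup>2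
        + (2 * real (card (insert k y \<inter> M)) - real (card (insert k Y \<inter> M)))\<^sup>2
        = 2 * (?z y)\<^sup>2 + 2 * of_bool (k \<in> M)"
      using insert.hyps by (cases "k \<in> M") (simp_all add: power2_eq_square algebra_simps)
  qed
  also have "\<dots> = 2 * (?n * 2 ^ card Y) + 2 * of_bool (k \<in> M) * 2 ^ card Y"
    using insert by (simp add: sum.distrib sum_distrib_left[symmetric] card_Pow)
  also have "\<dots> = real (card (insert k Y \<inter> M)) * 2 ^ card (insert k Y)"
    using insert.hyps by (cases "k \<in> M") (simp_all add: algebra_simps)
  finally show ?case .
qed simp

text \<open>Chebyshev's inequality: the variance is at most a quarter of the squared
  threshold.\<close>

lemma card_small_deviation_ge:
  assumes Y: "finite Y" and s: "4 * real (card (Y \<inter> M)) \<le> s\<^sup>2" "0 < s"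
  shows "3/4 * 2 ^ card Y \<le> real (card {y\<in>Pow Y. \<bar>2 * real (card (y \<inter> M)) - real (card (Y \<inter> M))\<bar> < s})"
proof -
  let ?z = "\<lambda>y. 2 * real (card (y \<inter> M)) - real (card (Y \<inter> M))"
  let ?G = "{y\<in>Pow Y. \<bar>?z y\<bar> < s}"
  have "real (card (Pow Y - ?G)) * s\<^sup>2 = (\<Sum>y\<in>Pow Y - ?G. s\<^sup>2)" by simp
  also have "\<dots> \<le> (\<Sum>y\<in>Pow Y - ?G. (?z y)\<^sup>2)"
  proof (rule sum_mono)
    fix y assume "y \<in> Pow Y - ?G"
    then have "s \<le> \<bar>?z y\<bar>" by auto
    then show "s\<^sup>2 \<le> (?z y)\<^sup>2" using s(2) by (metis abs_le_square_iff abs_of_pos)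
  qed
  also have "\<dots> \<le> (\<Sum>y\<in>Pow Y. (?z y)\<^sup>2)"
    by (rule sum_mono2) (use Y in auto)
  also have "\<dots> = real (card (Y \<inter> M)) * 2 ^ card Y" by (rule sum_deviation_sq[OF Y])
  also have "\<dots> \<le> (s\<^sup>2 / 4) * 2 ^ card Y" using s(1) by (intro mult_right_mono) auto
  finally have "real (card (Pow Y - ?G)) \<le> 2 ^ card Y / 4"
    using s(2) by (simp add: field_simps)
  moreover have "card (Pow Y - ?G) = card (Pow Y) - card ?G"
    by (rule card_Diff_subset) (use Y in \<open>auto intro: finite_subset[of _ "Pow Y"]\<close>)
  moreover have "card ?G \<le> card (Pow Y)" by (rule card_mono) (use Y in auto)
  ultimately show ?thesis using Y by (simp add: card_Pow of_nat_diff)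
qed

lemma odd_card_Int_insert:
  assumes "finite S" "k \<notin> S"
  shows "odd (card (A \<inter> insert k S)) = (odd (card (A \<inter> S)) \<noteq> (k \<in> A))"
  using assms by (cases "k \<in> A") auto

section \<open>Clipped instances: unate and far cases\<close>

text \<open>Coordinates \<open>m\<close> and \<open>m + 1\<close> are padding: they make the two parities nonconstant and
  independent of each other, whatever \<open>A\<close> and \<open>B\<close> are. Truncated subtraction of \<open>L\<close> and the minimum
  with \<open>r - 1\<close> clip to the \<open>r\<close> available values; the \<open>2\<close> prevents any truncation before that.\<close>
definition level :: "nat \<Rightarrow> nat \<Rightarrow> nat \<Rightarrow> nat set \<Rightarrow> nat set \<Rightarrow> nat set \<Rightarrow> nat" where
  "level r m L A B S = min (r - 1) (card (S \<inter> {..<m + 2}) + 2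
     - (of_bool (odd (card (insert m A \<inter> S))) + of_bool (odd (card (insert (m + 1) B \<inter> S)))) - L)"

definition instance_fun :: "real set \<Rightarrow> nat \<Rightarrow> nat \<Rightarrow> nat \<Rightarrow> nat set \<Rightarrow> nat set \<Rightarrow> bool list \<Rightarrow> real" where
  "instance_fun R d m L A B x = sorted_list_of_set R ! level (card R) m L A B (support d x)"

lemma finite_support [simp]: "finite (support d x)"
  by (simp add: support_def)

lemma level_less: "2 \<le> r \<Longrightarrow> level r m L A B S < r"
  by (auto simp: level_def)

lemma card_ge_2_imp_finite: "2 \<le> card R \<Longrightarrow> finite R"
  by (metis card.infinite not_numeral_le_zero)

lemma instance_fun_in:
  assumes "2 \<le> card R"
  shows "instance_fun R d m L A B x \<in> R"
proof -
  have "sorted_list_of_set R ! level (card R) m L A B (support d x) \<in> set (sorted_list_of_set R)"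
    using level_less[OF assms] by (intro nth_mem) simp
  then show ?thesis
    using card_ge_2_imp_finite[OF assms] by (simp add: instance_fun_def)
qed

lemma instance_fun_less:
  assumes "2 \<le> card R"
    and "level (card R) m L A B (support d x) < level (card R) m L A B (support d y)"
  shows "instance_fun R d m L A B x < instance_fun R d m L A B y"
  unfolding instance_fun_def
  by (rule sorted_wrt_nth_less[OF strict_sorted_list_of_set])
    (use assms level_less[OF assms(1)] in auto)

lemma instance_fun_le:
  assumes "2 \<le> card R"
    and "level (card R) m L A B (support d x) \<le> level (card R) m L A B (support d y)"
  shows "instance_fun R d m L A B x \<le> instance_fun R d m L A B y"
  using assms instance_fun_less[OF assms(1), of m L A B d x y]
  by (cases "level (card R) m L A B (support d x) = level (card R) m L A B (support d y)")
    (auto simp: instance_fun_def)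

lemma unate_instance_fun:
  assumes R: "2 \<le> card R" and AB: "A \<subseteq> {..<m}" "B \<subseteq> {..<m}" "A \<inter> B = {}"
  shows "unate d (instance_fun R d m L A B)"
  unfolding unate_def
proof (intro exI[of _ "\<lambda>_. True"] allI impI ballI)
  fix j x assume j: "j < d" and x: "x \<in> cube d" and nj: "\<not> x ! j"
  let ?S = "support d x"
  have "j \<notin> ?S" using nj by (simp add: support_def)
  note odd_insert = odd_card_Int_insert[OF finite_support this]
  have "level (card R) m L A B ?S \<le> level (card R) m L A B (insert j ?S)"
  proof (cases "j < m + 2")
    case True
    then have "card (insert j ?S \<inter> {..<m + 2}) = Suc (card (?S \<inter> {..<m + 2}))"
      using \<open>j \<notin> ?S\<close> by simp
    \<comment> \<open>By disjointness a step in direction \<open>j\<close> flips at most one parity,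
      which costs at most the one unit gained in cardinality. Clipping preserves the order.\<close>
    moreover have "\<not> (j \<in> insert m A \<and> j \<in> insert (m + 1) B)" using AB by auto
    ultimately show ?thesis unfolding level_def odd_insert
      by (intro min.mono order_refl diff_le_mono) auto
  next
    case False
    then have "insert j ?S \<inter> {..<m + 2} = ?S \<inter> {..<m + 2}" "j \<notin> insert m A" "j \<notin> insert (m + 1) B"
      using AB by auto
    then show ?thesis unfolding level_def odd_insert by simp
  qed
  then have "instance_fun R d m L A B x \<le> instance_fun R d m L A B (x[j := True])"
    by (intro instance_fun_le[OF R]) (simp add: support_update[OF x j])
  then show "(True \<longrightarrow> instance_fun R d m L A B x \<le> instance_fun R d m L A B (x[j := True])) \<and>
      (\<not> True \<longrightarrow> instance_fun R d m L A B (x[j := True]) \<le> instance_fun R d m L A B x)" by simp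
qed

text \<open>Sets the two padding bits so that both parities become \<open>p\<close>: bit
  \<open>m\<close> toggles only the first parity, bit \<open>m + 1\<close> only the second.\<close>

definition pad :: "nat \<Rightarrow> nat set \<Rightarrow> nat set \<Rightarrow> bool \<Rightarrow> nat set \<Rightarrow> nat set" where
  "pad m A B p y = y \<union> (if odd (card (insert m A \<inter> y)) = p then {} else {m})
     \<union> (if odd (card (insert (m + 1) B \<inter> y)) = p then {} else {m + 1})"

lemma pad_props:
  assumes y: "finite y" "m \<notin> y" "m + 1 \<notin> y" and AB: "A \<subseteq> {..<m}" "B \<subseteq> {..<m}"
  shows "odd (card (insert m A \<inter> pad m A B p y)) = p"
    and "odd (card (insert (m + 1) B \<inter> pad m A B p y)) = p"
    and "card (y \<inter> {..<m}) \<le> card (pad m A B p y \<inter> {..<m + 2})"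
    and "card (pad m A B p y \<inter> {..<m + 2}) \<le> card (y \<inter> {..<m}) + 2"
proof -
  \<comment> \<open>The parity computation uses only which of \<open>m\<close> and
    \<open>m + 1\<close> belong to the two sets, hence the abstract \<open>A'\<close> and
    \<open>B'\<close>.\<close>
  have "odd (card (A' \<inter> (y \<union> (if odd (card (A' \<inter> y)) = p then {} else {m})
        \<union> (if odd (card (B' \<inter> y)) = p then {} else {m + 1})))) = p
    \<and> odd (card (B' \<inter> (y \<union> (if odd (card (A' \<inter> y)) = p then {} else {m})
        \<union> (if odd (card (B' \<inter> y)) = p then {} else {m + 1})))) = p"
    if "m \<in> A'" "m \<notin> B'" "m + 1 \<notin> A'" "m + 1 \<in> B'" for A' B'
    using that odd_card_Int_insert[OF y(1,2), of A'] odd_card_Int_insert[OF y(1,2), of B']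
      odd_card_Int_insert[OF y(1,3), of A'] odd_card_Int_insert[OF y(1,3), of B']
      odd_card_Int_insert[of "insert m y" "m + 1" A'] odd_card_Int_insert[of "insert m y" "m + 1" B'] y
    by (cases "odd (card (A' \<inter> y)) = p"; cases "odd (card (B' \<inter> y)) = p"; cases p) simp_all
  moreover have "m \<notin> insert (m + 1) B" "m + 1 \<notin> insert m A" using AB by auto
  ultimately have "odd (card (insert m A \<inter> pad m A B p y)) = p \<and> odd (card (insert (m + 1) B \<inter> pad m A B p y)) = p"
    unfolding pad_def by (meson insertI1)
  then show "odd (card (insert m A \<inter> pad m A B p y)) = p" "odd (card (insert (m + 1) B \<inter> pad m A B p y)) = p"
    by (rule conjunct1, rule conjunct2)
  have "y \<inter> {..<m + 2} = y \<inter> {..<m}"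
  proof -
    have "{..<m + 2} = insert m (insert (m + 1) {..<m})" by auto
    then show ?thesis using y by simp
  qed
  then have "pad m A B p y \<inter> {..<m + 2} \<subseteq> insert m (insert (m + 1) (y \<inter> {..<m}))"
    by (auto simp: pad_def split: if_splits)
  then have "card (pad m A B p y \<inter> {..<m + 2}) \<le> card (insert m (insert (m + 1) (y \<inter> {..<m})))"
    using y by (intro card_mono) auto
  also have "\<dots> \<le> card (y \<inter> {..<m}) + 2" using y by (simp add: card_insert_if)
  finally show "card (pad m A B p y \<inter> {..<m + 2}) \<le> card (y \<inter> {..<m}) + 2" .
  show "card (y \<inter> {..<m}) \<le> card (pad m A B p y \<inter> {..<m + 2})"
    by (rule card_mono) (auto simp: pad_def)
qed

text \<open>Direction \<open>i\<close> flips both parities. From even parities the unclipped value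
  changes by 1 - 2 = -1, from odd ones by 1 + 2 = 3. Padding realises both cases for every choice of
  the remaining coordinates, and the bounds on \<open>L\<close> keep typical choices clear of the
  clipping.\<close>

lemma far_instance_fun:
  assumes R: "2 \<le> card R" and i: "i < m" and m: "m + 2 \<le> d"
    and AB: "A \<subseteq> {..<m}" "B \<subseteq> {..<m}" "i \<in> A" "i \<in> B"
    and s: "4 * real m \<le> s\<^sup>2" "0 < s"
    and L: "2 * real L \<le> real m + 3 - s" "real m + 7 + s \<le> 2 * real (card R) + 2 * real L"
  shows "far_from_unate d (3/32) (instance_fun R d m L A B)"
proof (rule far_from_unateI)
  let ?f = "instance_fun R d m L A B" and ?r = "card R"
  let ?Y = "{..<d} - {i, m, m + 1}"
  let ?G = "{y\<in>Pow ?Y. \<bar>2 * real (card (y \<inter> {..<m})) - real (card (?Y \<inter> {..<m}))\<bar> < s}"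
  show "i < d" using i m by simp
  have "?Y \<inter> {..<m} = {..<m} - {i}" using m by auto
  then have cY: "card (?Y \<inter> {..<m}) = m - 1" using i by simp
  have "card ?Y = d - 3" using i m by (subst card_Diff_subset) auto
  \<comment> \<open>Three quarters of the \<open>2 ^ (d - 3)\<close> choices are typical, which
    gives the constant 3/32.\<close>
  moreover have "3/4 * 2 ^ card ?Y \<le> real (card ?G)"
    by (rule card_small_deviation_ge) (use s cY in auto)
  moreover have "(2::real) ^ d = 2 ^ (d - 3) * 2 ^ 3"
    unfolding power_add[symmetric] using i m by simp
  ultimately have G: "3/32 * 2 ^ d \<le> real (card ?G)" by simp
  have strict: "level ?r m L A B (insert i (pad m A B False y)) < level ?r m L A B (pad m A B False y)
      \<and> level ?r m L A B (pad m A B True y) < level ?r m L A B (insert i (pad m A B True y))"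
    and pad_sub: "pad m A B p y \<subseteq> {..<d}" and i_pad: "i \<notin> pad m A B p y"
    and pad_back: "pad m A B p y - {m, m + 1} = y" if "y \<in> ?G" for y p
  proof -
    have y: "finite y" "m \<notin> y" "m + 1 \<notin> y" "i \<notin> y" "y \<subseteq> {..<d}"
      using that finite_subset[of y ?Y] by auto
    show "pad m A B p y \<subseteq> {..<d}" using y m by (auto simp: pad_def)
    show i_pad: "i \<notin> pad m A B p y" for p using y i by (auto simp: pad_def)
    show "pad m A B p y - {m, m + 1} = y" using y by (auto simp: pad_def)
    have fin: "finite (pad m A B p y)" for p using y by (simp add: pad_def)
    note pp = pad_props[OF y(1-3) AB(1,2)]
    note odd_insert = odd_card_Int_insert[OF fin i_pad]
    let ?u = "card (y \<inter> {..<m})"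
    from that have "\<bar>2 * real ?u - real (card (?Y \<inter> {..<m}))\<bar> < s" by blast
    then have "\<bar>2 * real ?u - (real m - 1)\<bar> < s" unfolding cY using i by (simp add: of_nat_diff)
    then have "2 * real L < 2 * real ?u + 4" "2 * real ?u + 8 < 2 * real ?r + 2 * real L" using L by linarith+
    \<comment> \<open>The first bound avoids clipping at the bottom. The second avoids it at the top
      even when padding raises the cardinality by two.\<close>
    then have u: "L < ?u + 2" "?u + 4 < ?r + L" by linarith+
    have ci: "card (insert i (pad m A B p y) \<inter> {..<m + 2}) = Suc (card (pad m A B p y \<inter> {..<m + 2}))" for p
      using i i_pad fin by simp
    have iAB: "i \<in> insert m A" "i \<in> insert (m + 1) B" using AB by auto
    show "level ?r m L A B (insert i (pad m A B False y)) < level ?r m L A B (pad m A B False y)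
      \<and> level ?r m L A B (pad m A B True y) < level ?r m L A B (insert i (pad m A B True y))"
      unfolding level_def odd_insert pp(1,2) ci using iAB u pp(3,4)[of True] pp(3,4)[of False]
      by simp (intro conjI; linarith)
  qed
  have inj: "inj_on (\<lambda>y. of_support d (pad m A B p y)) ?G" for p
    by (rule inj_on_inverseI[where g = "\<lambda>x. support d x - {m, m + 1}"])
      (simp only: support_of_support[OF pad_sub] pad_back)
  have nth: "\<not> of_support d (pad m A B p y) ! i" if "y \<in> ?G" for y p
    using i_pad[OF that] i m by (simp add: of_support_def)
  have supp: "support d ((of_support d (pad m A B p y))[i := True]) = insert i (pad m A B p y)"
    "support d (of_support d (pad m A B p y)) = pad m A B p y" if "y \<in> ?G" for y p
    using support_update[of "of_support d (pad m A B p y)" d i] support_of_support[OF pad_sub[OF that]] i m by simp_all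
  have "card ?G \<le> card {x\<in>cube d. \<not> x ! i \<and> ?f (x[i := True]) < ?f x}"
    by (rule card_inj_on_le[OF inj[of False]])
      (use nth strict supp in \<open>auto intro!: instance_fun_less[OF R]\<close>)
  then show "3/32 * 2 ^ d \<le> real (card {x\<in>cube d. \<not> x ! i \<and> ?f (x[i := True]) < ?f x})"
    using G by linarith
  have "card ?G \<le> card {x\<in>cube d. \<not> x ! i \<and> ?f x < ?f (x[i := True])}"
    by (rule card_inj_on_le[OF inj[of True]])
      (use nth strict supp in \<open>auto intro!: instance_fun_less[OF R]\<close>)
  then show "3/32 * 2 ^ d \<le> real (card {x\<in>cube d. \<not> x ! i \<and> ?f x < ?f (x[i := True])})"
    using G by linarith
qed

subsection \<open>The query bound\<close>

text \<open>Averaging over the random instances: each pair of instances forces an acceptance gap of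
  at least 1/3 on the tester, whereas \<open>gap_tree\<close> bounds the total gap of every
  deterministic tree in its support.\<close>

lemma tester_query_bound:
  assumes T: "unateness_tester d R (3/32) T q"
    and R: "2 \<le> card R" and m: "m + 2 \<le> d" "0 < m"
    and s: "4 * real m \<le> s\<^sup>2" "0 < s"
    and L: "2 * real L \<le> real m + 3 - s" "real m + 7 + s \<le> 2 * real (card R) + 2 * real L"
  shows "real m \<le> 24 * real q"
proof -
  let ?N = "{..<m}"
  \<comment> \<open>Intersecting with \<open>?N\<close> makes the formula for \<open>F\<close> in
    terms of parities valid for all sets, as \<open>gap_tree\<close> requires.\<close>
  define F where "F A B = instance_fun R d m L (A \<inter> ?N) (B \<inter> ?N)" for A B
  \<comment> \<open>The padding bits are read off the queried point, so only the parities on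
    \<open>?N\<close> remain as unknowns.\<close>
  define V where "V x a b = sorted_list_of_set R ! min (card R - 1) (card (support d x \<inter> {..<m + 2}) + 2
     - (of_bool (a \<noteq> (m \<in> support d x)) + of_bool (b \<noteq> (m + 1 \<in> support d x))) - L)" for x a b
  have parity: "odd (card (insert k (A \<inter> ?N) \<inter> S)) = (odd (card (A \<inter> (S \<inter> ?N))) \<noteq> (k \<in> S))"
    if "m \<le> k" for k A and S :: "nat set"
  proof -
    have "A \<inter> ?N \<inter> S = A \<inter> (S \<inter> ?N)" "k \<notin> A \<inter> (S \<inter> ?N)" "finite (A \<inter> (S \<inter> ?N))" using that by auto
    then show ?thesis by (cases "k \<in> S") simp_all
  qed
  have F: "F A B x = V x (odd (card (A \<inter> (support d x \<inter> ?N)))) (odd (card (B \<inter> (support d x \<inter> ?N))))" for A B x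
    by (simp only: F_def V_def instance_fun_def level_def parity[OF order_refl] parity[OF le_add1])
  have acc: "measure_pmf.prob T {t. run d t (F A B)} - measure_pmf.prob T {t. run d t (F (insert i A) (insert i B))} \<ge> 1/3"
    if "i \<in> ?N" "U \<in> Pow (?N - {i})" "A \<in> Pow U" "B \<in> Pow (?N - {i} - U)" for i U A B
  proof -
    have AB: "A \<inter> ?N \<inter> (B \<inter> ?N) = {}" "i < m" "i \<in> insert i A \<inter> ?N" "i \<in> insert i B \<inter> ?N" using that by auto
    have rng: "\<forall>x\<in>cube d. F A B x \<in> R" for A B using instance_fun_in[OF R] by (simp add: F_def)
    have "unate d (F A B)"
      unfolding F_def by (rule unate_instance_fun[OF R]) (use AB in auto)
    moreover have "far_from_unate d (3/32) (F (insert i A) (insert i B))"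
      unfolding F_def by (rule far_instance_fun[OF R AB(2) m(1) _ _ AB(3,4) s L]) auto
    ultimately have "measure_pmf.prob T {t. run d t (F A B)} \<ge> 2/3"
      "measure_pmf.prob T {t. \<not> run d t (F (insert i A) (insert i B))} \<ge> 2/3"
      using T rng unfolding unateness_tester_def by blast+
    moreover have "measure_pmf.prob T {t. \<not> run d t (F (insert i A) (insert i B))}
        = 1 - measure_pmf.prob T {t. run d t (F (insert i A) (insert i B))}"
      using measure_pmf.prob_compl[of "{t. run d t (F (insert i A) (insert i B))}" T]
      by (simp add: Compl_eq_Diff_UNIV[symmetric] Collect_neg_eq)
    ultimately show ?thesis by linarith
  qed
  have int: "integrable (measure_pmf T) (\<lambda>t. of_bool (P t) :: real)" for P
    by (rule measure_pmf.integrable_const_bound[where B = 1]) auto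
  have exp: "measure_pmf.expectation T (\<lambda>t. of_bool (P t)) = measure_pmf.prob T {t. P t}" for P
  proof -
    have "(\<lambda>t. of_bool (P t) :: real) = indicator {t. P t}" by (auto simp: indicator_def)
    then show ?thesis by simp
  qed
  have "real m * (2 ^ (m - 1) * (2 ^ (m - 1) / 3)) =
      (\<Sum>i\<in>?N. \<Sum>U\<in>Pow (?N - {i}). \<Sum>A\<in>Pow U. \<Sum>B\<in>Pow (?N - {i} - U). 1/3)"
  proof -
    have "(\<Sum>A\<in>Pow U. \<Sum>B\<in>Pow (?N - {i} - U). 1/3) = (2 ^ (m - 1) / 3 :: real)"
      if "i \<in> ?N" "U \<in> Pow (?N - {i})" for i U
    proof -
      have fin: "finite U" using that finite_subset[of U ?N] by auto
      have "card (?N - {i}) = card U + card (?N - {i} - U)"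
        using that fin card_mono[of "?N - {i}" U] card_Diff_subset[of U "?N - {i}"] by auto
      then have "m - 1 = card U + card (?N - {i} - U)" using that by simp
      then show ?thesis using fin by (simp add: card_Pow power_add)
    qed
    then show ?thesis by (simp add: card_Pow)
  qed
  also have "\<dots> \<le> (\<Sum>i\<in>?N. \<Sum>U\<in>Pow (?N - {i}). \<Sum>A\<in>Pow U. \<Sum>B\<in>Pow (?N - {i} - U).
      measure_pmf.prob T {t. run d t (F A B)} - measure_pmf.prob T {t. run d t (F (insert i A) (insert i B))})"
    by (intro sum_mono) (rule acc)
  also have "\<dots> = measure_pmf.expectation T (\<lambda>t. gap ?N [] [] (\<lambda>A B. run d t (F A B)))"
    by (simp add: gap_def satisfies_def int exp)
  also have "\<dots> \<le> 2 * real q * 4 ^ m"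
  proof (rule measure_pmf.integral_le_const)
    show "integrable (measure_pmf T) (\<lambda>t. gap ?N [] [] (\<lambda>A B. run d t (F A B)))"
      by (simp add: gap_def int)
    show "AE t in measure_pmf T. gap ?N [] [] (\<lambda>A B. run d t (F A B)) \<le> 2 * real q * 4 ^ m"
    proof (rule AE_pmfI)
      fix t assume "t \<in> set_pmf T"
      then have "depth_le t q" using T by (auto simp: unateness_tester_def)
      from gap_tree[where N = ?N and F = F and V = V and s = "\<lambda>x. support d x \<inter> ?N" and cs = "[]" and cs' = "[]",
          OF finite_lessThan F this]
      show "gap ?N [] [] (\<lambda>A B. run d t (F A B)) \<le> 2 * real q * 4 ^ m"
        by (simp add: weight_Nil)
    qed
  qed
  \<comment> \<open>Cancelling the common power leaves m / 3 \<le> 8 q.\<close>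
  also have "(4::real) ^ m = 4 * (2 ^ (m - 1) * 2 ^ (m - 1))"
    using m(2) by (cases m) (simp_all add: power_mult_distrib[symmetric])
  finally have "(2 ^ (m - 1) * 2 ^ (m - 1)) * real m \<le> (2 ^ (m - 1) * 2 ^ (m - 1)) * (24 * real q)"
    by (simp add: mult_ac)
  then show ?thesis by (subst (asm) mult_le_cancel_left_pos) auto
qed

section \<open>Small ranges and the choice of parameters\<close>

lemma card_cube: "card (cube n) = 2 ^ n"
  using card_lists_length_eq[of "UNIV :: bool set" n] by (simp add: cube_def)

text \<open>Without queries the verdict is independent of the function, yet a constant function must
  be accepted and a far one rejected. This handles ranges too small for the main
  construction.\<close>

lemma tester_makes_query:
  assumes T: "unateness_tester d R (3/32) T q" and R: "2 \<le> card R" and d: "2 \<le> d"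
  shows "1 \<le> q"
proof (rule ccontr)
  assume "\<not> 1 \<le> q"
  then have leaf: "\<exists>b. t = Leaf b" if "t \<in> set_pmf T" for t
  proof -
    have "q = 0" using \<open>\<not> 1 \<le> q\<close> by simp
    then have "depth_le t 0" using T that unfolding unateness_tester_def by blast
    then show ?thesis by cases auto
  qed
  from R obtain a b where ab: "a \<in> R" "b \<in> R" "a < b"
    by (metis card_le_Suc0_iff_eq card_ge_2_imp_finite not_less_eq_eq numeral_2_eq_2 linorder_neqE)
  \<comment> \<open>The exclusive or of the first two bits: bit 1 decides whether direction 0 goes
    up or down, so each case covers \<open>2 ^ (d - 2)\<close> edges.\<close>
  let ?f = "\<lambda>x :: bool list. if x ! 0 = x ! 1 then a else b"
  have edge: "3/32 * 2 ^ d \<le> real (card {x\<in>cube d. \<not> x ! 0 \<and> P x})"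
    if P: "\<And>y. y \<in> cube (d - 2) \<Longrightarrow> P (False # v # y)" for v P
  proof -
    have "card (cube (d - 2)) \<le> card {x\<in>cube d. \<not> x ! 0 \<and> P x}"
    proof (rule card_inj_on_le)
      show "inj_on (\<lambda>y. False # v # y) (cube (d - 2))" by (rule inj_onI) simp
      show "(\<lambda>y. False # v # y) ` cube (d - 2) \<subseteq> {x\<in>cube d. \<not> x ! 0 \<and> P x}"
        using P d by (auto simp: cube_def)
    qed simp
    then have lower: "(2::real) ^ (d - 2) \<le> real (card {x\<in>cube d. \<not> x ! 0 \<and> P x})"
      by (simp add: card_cube)
    have "(2::real) ^ d = 2 ^ (d - 2) * 2 ^ 2"
      unfolding power_add[symmetric] le_add_diff_inverse2[OF d] ..
    also have "3/32 * \<dots> \<le> (2::real) ^ (d - 2)" by simp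
    finally show ?thesis using lower by (rule order_trans)
  qed
  have "far_from_unate d (3/32) ?f"
  proof (rule far_from_unateI)
    show "3/32 * 2 ^ d \<le> real (card {x\<in>cube d. \<not> x ! 0 \<and> ?f (x[0 := True]) < ?f x})"
      by (rule edge[where v = True]) (use ab in auto)
    show "3/32 * 2 ^ d \<le> real (card {x\<in>cube d. \<not> x ! 0 \<and> ?f x < ?f (x[0 := True])})"
      by (rule edge[where v = False]) (use ab in auto)
  qed (use d in simp)
  moreover have "unate d (\<lambda>_. a)" by (simp add: unate_def)
  ultimately have "2/3 \<le> measure_pmf.prob T {t. run d t (\<lambda>_. a)}" "2/3 \<le> measure_pmf.prob T {t. \<not> run d t ?f}"
    using T ab unfolding unateness_tester_def by auto
  moreover have "measure_pmf.prob T {t. \<not> run d t ?f} = measure_pmf.prob T {t. \<not> run d t (\<lambda>_. a)}"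
    by (rule measure_pmf.finite_measure_eq_AE) (use leaf in \<open>force intro!: AE_pmfI\<close>)+
  moreover have "measure_pmf.prob T {t. \<not> run d t (\<lambda>_. a)} = 1 - measure_pmf.prob T {t. run d t (\<lambda>_. a)}"
    using measure_pmf.prob_compl[of "{t. run d t (\<lambda>_. a)}" T]
    by (simp add: Compl_eq_Diff_UNIV[symmetric] Collect_neg_eq)
  ultimately show False by linarith
qed

lemma tester_range_bound:
  assumes T: "unateness_tester d R (3/32) T q" and R: "2 \<le> card R"
    and d: "3 \<le> d" "(card R)\<^sup>2 \<le> d"
  shows "1/480 * real (card R) ^ 2 \<le> real q"
proof (cases "card R < 16")
  case True
  have "1 \<le> q" by (rule tester_makes_query[OF T R]) (use d in simp)
  moreover have "real (card R) ^ 2 \<le> 16 ^ 2" using True by (intro power_mono) auto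
  ultimately show ?thesis by simp
next
  case False
  define r m where "r = card R" and "m = r\<^sup>2 div 16"
  have r: "16 \<le> r" using False by (simp add: r_def)
  have m: "16 * m \<le> r\<^sup>2" "r\<^sup>2 < 16 * m + 16" unfolding m_def by linarith+
  have "16 * r \<le> r\<^sup>2" using r by (simp add: power2_eq_square)
  then have mr: "r \<le> m" using m by linarith
  have "real m \<le> 24 * real q"
  \<comment> \<open>This \<open>L\<close> centres the window of \<open>r\<close> values near the
    mean m / 2. Subtracting 8 in \<open>s\<close> leaves slack for padding and rounding, and
    \<open>r \<ge> 16\<close> gives \<open>s \<ge> r / 2\<close>, hence enough room for
    Chebyshev.\<close>
  proof (rule tester_query_bound[OF T R, where s = "real r - 8" and L = "(m - r) div 2"])
    have "(real r / 2)\<^sup>2 \<le> (real r - 8)\<^sup>2" using r by (intro power_mono) auto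
    moreover have "16 * real m \<le> (real r)\<^sup>2" using m(1) by (metis of_nat_le_iff of_nat_mult of_nat_numeral of_nat_power)
    ultimately show "4 * real m \<le> (real r - 8)\<^sup>2" by (simp add: power_divide)
    show "m + 2 \<le> d" using m(1) d unfolding r_def by linarith
    show "0 < m" "0 < real r - 8" using r mr by auto
    have "2 * ((m - r) div 2) \<le> m - r" "m - r \<le> 2 * ((m - r) div 2) + 1" by linarith+
    then have "2 * real ((m - r) div 2) \<le> real m - real r" "real m - real r \<le> 2 * real ((m - r) div 2) + 1"
      using mr by linarith+
    then show "2 * real ((m - r) div 2) \<le> real m + 3 - (real r - 8)"
      "real m + 7 + (real r - 8) \<le> 2 * real (card R) + 2 * real ((m - r) div 2)"
      by (simp_all add: r_def)
  qed
  moreover have "(real r)\<^sup>2 < 16 * real m + 16"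
    using m(2) by (metis (mono_tags) of_nat_add of_nat_less_iff of_nat_mult of_nat_numeral of_nat_power)
  \<comment> \<open>The additive 16 is at most a sixteenth of the square of \<open>r\<close>, so the
    factor 16 * 24 = 384 grows to less than 480.\<close>
  moreover have "(16::real)\<^sup>2 \<le> (real r)\<^sup>2" using r by (intro power_mono) auto
  ultimately show ?thesis by (simp add: r_def)
qed

theorem theorem10:
  shows "\<exists>\<epsilon>0>0. \<forall>Rs :: nat \<Rightarrow> real set.
     (\<forall>d. 2 \<le> card (Rs d)) \<longrightarrow>
     (\<lambda>d. real (card (Rs d))) \<in> o(\<lambda>d. sqrt (real d)) \<longrightarrow>
     (\<exists>c>0. \<forall>\<^sub>F d in sequentially. \<forall>T q. unateness_tester d (Rs d) \<epsilon>0 T q \<longrightarrow>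
          real q \<ge> c * real (card (Rs d)) ^ 2)"
proof (rule exI[of _ "3/32"], intro conjI allI impI)
  fix Rs :: "nat \<Rightarrow> real set"
  assume R: "\<forall>d. 2 \<le> card (Rs d)" and small: "(\<lambda>d. real (card (Rs d))) \<in> o(\<lambda>d. sqrt (real d))"
  \<comment> \<open>The little-o bound with constant 1 already gives the hypothesis
    \<open>(card R)\<^sup>2 \<le> d\<close> of \<open>tester_range_bound\<close>.\<close>
  have "\<forall>\<^sub>F d in sequentially. norm (real (card (Rs d))) \<le> 1 * norm (sqrt (real d))"
    by (rule landau_o.smallD[OF small]) simp
  then have "\<forall>\<^sub>F d in sequentially. \<forall>T q. unateness_tester d (Rs d) (3/32) T q \<longrightarrow>
      1/480 * real (card (Rs d)) ^ 2 \<le> real q"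
    using eventually_ge_at_top[of 3]
  proof eventually_elim
    case (elim d)
    then have "real (card (Rs d)) \<le> sqrt (real d)" by simp
    then have "(real (card (Rs d)))\<^sup>2 \<le> real d" using power_mono[of "real (card (Rs d))" "sqrt (real d)" 2] by simp
    then have "(card (Rs d))\<^sup>2 \<le> d" by (metis of_nat_le_iff of_nat_power)
    with elim R show ?case using tester_range_bound by blast
  qed
  then show "\<exists>c>0. \<forall>\<^sub>F d in sequentially. \<forall>T q. unateness_tester d (Rs d) (3/32) T q \<longrightarrow>
      c * real (card (Rs d)) ^ 2 \<le> real q"
    by (intro exI[of _ "1/480"]) simp
qed simp

end
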